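(* The Onsager algebra $\mathcal{O}$ is isomorphic, as a Lie algebra over $k$, to the Dolan-Grady algebra $\mathcal{OA}$.
   Context: $k$ is an arbitrary field of characteristic zero. The Onsager algebra $\mathcal{O}$ is the (Lie) algebra over $k$ with basis $\{A_m, G_l \mid m\in\mathbb{Z},\ l\in\mathbb{N}_+\}$, where $\mathbb{N}_+=\{1,2,\dots\}$, and antisymmetric bilinear product given by $[A_l,A_m]=2G_{l-m}$ for $l>m$, $[G_l,A_m]=A_{m+l}-A_{m-l}$, and $[G_l,G_m]=0$. The Dolan-Grady algebra $\mathcal{OA}$ is the Lie algebra over $k$ presented by generators $A,B$ and relations $[A,[A,[A,B]]]=4[A,B]$ and $[B,[B,[B,A]]]=4[B,A]$. *)

theory Defs
  imports Complex_Main "HOL-Library.Poly_Mapping"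
begin

section \<open>Algebras over a field, ideals, Lie algebras\<close>

locale nonassoc_algebra = vector_space scale
  for scale :: "'k::field \<Rightarrow> 'a::ab_group_add \<Rightarrow> 'a" +
  fixes bracket :: "'a \<Rightarrow> 'a \<Rightarrow> 'a"
  assumes bracket_add_left: "bracket (x + y) z = bracket x z + bracket y z"
    and bracket_add_right: "bracket x (y + z) = bracket x y + bracket x z"
    and bracket_scale_left: "bracket (scale c x) y = scale c (bracket x y)"
    and bracket_scale_right: "bracket x (scale c y) = scale c (bracket x y)"
begin

definition ideal :: "'a set \<Rightarrow> bool"
  where "ideal I \<longleftrightarrow> subspace I \<and> (\<forall>a. \<forall>x\<in>I. bracket a x \<in> I \<and> bracket x a \<in> I)"

definition ideal_generated :: "'a set \<Rightarrow> 'a set"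
  where "ideal_generated S = ideal hull S"

definition cong_mod :: "'a set \<Rightarrow> 'a \<Rightarrow> 'a \<Rightarrow> bool"
  where "cong_mod S x y \<longleftrightarrow> x - y \<in> ideal_generated S"

lemma ideal_ideal_generated: "ideal (ideal_generated S)"
  unfolding ideal_generated_def
  by (rule hull_in) (auto simp: ideal_def subspace_def)

lemma
  shows ideal_generated_0: "0 \<in> ideal_generated S"
    and ideal_generated_add:
      "x \<in> ideal_generated S \<Longrightarrow> y \<in> ideal_generated S \<Longrightarrow> x + y \<in> ideal_generated S"
    and ideal_generated_diff:
      "x \<in> ideal_generated S \<Longrightarrow> y \<in> ideal_generated S \<Longrightarrow> x - y \<in> ideal_generated S"
    and ideal_generated_uminus: "x \<in> ideal_generated S \<Longrightarrow> - x \<in> ideal_generated S"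
    and ideal_generated_scale: "x \<in> ideal_generated S \<Longrightarrow> scale c x \<in> ideal_generated S"
    and ideal_generated_bracket_left: "x \<in> ideal_generated S \<Longrightarrow> bracket a x \<in> ideal_generated S"
    and ideal_generated_bracket_right: "x \<in> ideal_generated S \<Longrightarrow> bracket x a \<in> ideal_generated S"
  using ideal_ideal_generated[of S]
  by (auto simp: ideal_def subspace_0 subspace_add subspace_diff subspace_neg subspace_scale)

lemma bracket_zero_left [simp]: "bracket 0 y = 0"
  using bracket_add_left[of 0 0 y] by simp

lemma bracket_zero_right [simp]: "bracket x 0 = 0"
  using bracket_add_right[of x 0 0] by simp

lemma bracket_minus_left: "bracket (- x) y = - bracket x y"
  using bracket_add_left[of "- x" x y] by (simp add: eq_neg_iff_add_eq_0)

lemma bracket_minus_right: "bracket x (- y) = - bracket x y"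
  using bracket_add_right[of x "- y" y] by (simp add: eq_neg_iff_add_eq_0)

lemma bracket_diff_left: "bracket (x - y) z = bracket x z - bracket y z"
  using bracket_add_left[of x "- y" z] by (simp add: bracket_minus_left)

lemma bracket_diff_right: "bracket x (y - z) = bracket x y - bracket x z"
  using bracket_add_right[of x y "- z"] by (simp add: bracket_minus_right)

lemma equivp_cong_mod: "equivp (cong_mod S)"
proof (rule equivpI)
  show "reflp (cong_mod S)"
    by (auto simp: reflp_def cong_mod_def ideal_generated_0)
  show "symp (cong_mod S)"
    by (auto simp: symp_def cong_mod_def dest: ideal_generated_uminus)
  show "transp (cong_mod S)"
    unfolding transp_def cong_mod_def by (metis ideal_generated_add diff_add_cancel add_diff_eq)
qed

lemma cong_mod_add: "cong_mod S x x' \<Longrightarrow> cong_mod S y y' \<Longrightarrow> cong_mod S (x + y) (x' + y')"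
  unfolding cong_mod_def by (metis ideal_generated_add add_diff_add)

lemma cong_mod_uminus: "cong_mod S x x' \<Longrightarrow> cong_mod S (- x) (- x')"
  unfolding cong_mod_def by (metis ideal_generated_uminus minus_diff_minus)

lemma cong_mod_diff: "cong_mod S x x' \<Longrightarrow> cong_mod S y y' \<Longrightarrow> cong_mod S (x - y) (x' - y')"
  using cong_mod_add cong_mod_uminus by (metis diff_conv_add_uminus)

lemma cong_mod_scale: "cong_mod S x x' \<Longrightarrow> cong_mod S (scale c x) (scale c x')"
  unfolding cong_mod_def by (metis ideal_generated_scale scale_right_diff_distrib)

lemma cong_mod_bracket:
  assumes "cong_mod S x x'" "cong_mod S y y'"
  shows "cong_mod S (bracket x y) (bracket x' y')"
proof -
  have "bracket x y - bracket x' y' = bracket (x - x') y + bracket x' (y - y')"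
    by (simp add: bracket_diff_left bracket_diff_right)
  with assms show ?thesis
    unfolding cong_mod_def
    by (simp add: ideal_generated_add ideal_generated_bracket_left ideal_generated_bracket_right)
qed

lemma cong_mod_generator: "x \<in> S \<Longrightarrow> cong_mod S x 0"
  by (simp add: cong_mod_def ideal_generated_def hull_inc)

end

locale lie_algebra = nonassoc_algebra +
  assumes bracket_self: "bracket x x = 0"
    and jacobi:
      "bracket x (bracket y z) + bracket y (bracket z x) + bracket z (bracket x y) = 0"

locale lie_algebra_hom =
  source: lie_algebra scale\<^sub>1 bracket\<^sub>1 + target: lie_algebra scale\<^sub>2 bracket\<^sub>2 +
  Vector_Spaces.linear scale\<^sub>1 scale\<^sub>2 f
  for scale\<^sub>1 :: "'k::field \<Rightarrow> 'a::ab_group_add \<Rightarrow> 'a" and bracket\<^sub>1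
    and scale\<^sub>2 :: "'k \<Rightarrow> 'b::ab_group_add \<Rightarrow> 'b" and bracket\<^sub>2
    and f :: "'a \<Rightarrow> 'b" +
  assumes map_bracket: "f (bracket\<^sub>1 x y) = bracket\<^sub>2 (f x) (f y)"

definition lie_algebra_isomorphic ::
  "('k::field \<Rightarrow> 'a::ab_group_add \<Rightarrow> 'a) \<Rightarrow> ('a \<Rightarrow> 'a \<Rightarrow> 'a) \<Rightarrow>
   ('k \<Rightarrow> 'b::ab_group_add \<Rightarrow> 'b) \<Rightarrow> ('b \<Rightarrow> 'b \<Rightarrow> 'b) \<Rightarrow> bool"
  where "lie_algebra_isomorphic scale\<^sub>1 bracket\<^sub>1 scale\<^sub>2 bracket\<^sub>2 \<longleftrightarrow>
    (\<exists>f. lie_algebra_hom scale\<^sub>1 bracket\<^sub>1 scale\<^sub>2 bracket\<^sub>2 f \<and> bij f)"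


section \<open>Vector spaces with a given basis and structure constants\<close>

text \<open>The type \<^typ>\<open>'b \<Rightarrow>\<^sub>0 'k\<close> of finitely supported functions is the vector space over \<^typ>\<open>'k\<close> with
  basis \<^typ>\<open>'b\<close>; the basis vector belonging to \<open>b\<close> is \<open>Poly_Mapping.single b 1\<close>.\<close>

definition pm_scale :: "'k::field \<Rightarrow> ('b \<Rightarrow>\<^sub>0 'k) \<Rightarrow> ('b \<Rightarrow>\<^sub>0 'k)"
  where "pm_scale c p = Poly_Mapping.map ((*) c) p"

definition bilinear_extension ::
  "('b \<Rightarrow> 'b \<Rightarrow> ('b \<Rightarrow>\<^sub>0 'k::field)) \<Rightarrow> ('b \<Rightarrow>\<^sub>0 'k) \<Rightarrow> ('b \<Rightarrow>\<^sub>0 'k) \<Rightarrow> ('b \<Rightarrow>\<^sub>0 'k)"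
  where "bilinear_extension m p q =
    (\<Sum>a\<in>Poly_Mapping.keys p. \<Sum>b\<in>Poly_Mapping.keys q.
      pm_scale (Poly_Mapping.lookup p a * Poly_Mapping.lookup q b) (m a b))"

lemma lookup_pm_scale [simp]:
  "Poly_Mapping.lookup (pm_scale c p) b = c * Poly_Mapping.lookup p b"
  by (simp add: pm_scale_def Poly_Mapping.map.rep_eq when_def)

lemma vector_space_pm_scale: "vector_space pm_scale"
  by unfold_locales (auto intro!: poly_mapping_eqI simp: lookup_add algebra_simps)

lemma bilinear_extension_superset:
  assumes "finite A" "finite B" "Poly_Mapping.keys p \<subseteq> A" "Poly_Mapping.keys q \<subseteq> B"
  shows "bilinear_extension m p q =
    (\<Sum>a\<in>A. \<Sum>b\<in>B. pm_scale (Poly_Mapping.lookup p a * Poly_Mapping.lookup q b) (m a b))"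
proof -
  interpret vector_space pm_scale by (rule vector_space_pm_scale)
  have "bilinear_extension m p q = (\<Sum>a\<in>Poly_Mapping.keys p. \<Sum>b\<in>B.
      pm_scale (Poly_Mapping.lookup p a * Poly_Mapping.lookup q b) (m a b))"
    unfolding bilinear_extension_def
    by (intro sum.cong refl sum.mono_neutral_left) (use assms in \<open>auto simp: in_keys_iff\<close>)
  also have "\<dots> = (\<Sum>a\<in>A. \<Sum>b\<in>B.
      pm_scale (Poly_Mapping.lookup p a * Poly_Mapping.lookup q b) (m a b))"
    by (intro sum.mono_neutral_left) (use assms in \<open>auto simp: in_keys_iff\<close>)
  finally show ?thesis .
qed

lemma nonassoc_algebra_bilinear_extension: "nonassoc_algebra pm_scale (bilinear_extension m)"
proof -
  interpret vector_space pm_scale by (rule vector_space_pm_scale)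
  show ?thesis
  proof
    fix x y z :: "'b \<Rightarrow>\<^sub>0 'a" and c :: 'a
    let ?A = "Poly_Mapping.keys x \<union> Poly_Mapping.keys y \<union> Poly_Mapping.keys z \<union>
      Poly_Mapping.keys (x + y) \<union> Poly_Mapping.keys (y + z) \<union>
      Poly_Mapping.keys (pm_scale c x) \<union> Poly_Mapping.keys (pm_scale c y)"
    have *: "bilinear_extension m p q = (\<Sum>a\<in>?A. \<Sum>b\<in>?A.
        pm_scale (Poly_Mapping.lookup p a * Poly_Mapping.lookup q b) (m a b))"
      if "Poly_Mapping.keys p \<subseteq> ?A" "Poly_Mapping.keys q \<subseteq> ?A" for p q
      using that by (intro bilinear_extension_superset) simp_all
    show "bilinear_extension m (x + y) z = bilinear_extension m x z + bilinear_extension m y z"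
      by (subst (1 2 3) *)
        (auto simp: lookup_add scale_left_distrib ring_distribs simp flip: sum.distrib)
    show "bilinear_extension m x (y + z) = bilinear_extension m x y + bilinear_extension m x z"
      by (subst (1 2 3) *)
        (auto simp: lookup_add scale_left_distrib ring_distribs simp flip: sum.distrib)
    show "bilinear_extension m (pm_scale c x) y = pm_scale c (bilinear_extension m x y)"
      by (subst (1 2) *) (auto simp: scale_sum_right mult_ac)
    show "bilinear_extension m x (pm_scale c y) = pm_scale c (bilinear_extension m x y)"
      by (subst (1 2) *) (auto simp: scale_sum_right mult_ac)
  qed
qed

lemma bilinear_extension_single:
  "bilinear_extension m (Poly_Mapping.single a 1) (Poly_Mapping.single b 1) = m a b"
proof -
  interpret vector_space pm_scale by (rule vector_space_pm_scale)
  show ?thesis by (simp add: bilinear_extension_def)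
qed


section \<open>The Onsager algebra\<close>

text \<open>\<^typ>\<open>num\<close> is the type of positive integers, so the constructor \<open>G\<close> is indexed by 1, 2, ...
  (\<open>nat_of_num\<close> is the embedding; \<open>num_of_nat\<close> is its inverse on positive numbers and is
  only applied to positive numbers below).\<close>

datatype onsager_basis = A int | G num

fun onsager_structure :: "onsager_basis \<Rightarrow> onsager_basis \<Rightarrow> (onsager_basis \<Rightarrow>\<^sub>0 'k::field)" where
  "onsager_structure (A l) (A m) =
    (if l > m then Poly_Mapping.single (G (num_of_nat (nat (l - m)))) 2
     else if l < m then - Poly_Mapping.single (G (num_of_nat (nat (m - l)))) 2
     else 0)"
| "onsager_structure (G l) (A m) =
    Poly_Mapping.single (A (m + int (nat_of_num l))) 1
    - Poly_Mapping.single (A (m - int (nat_of_num l))) 1"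
| "onsager_structure (A m) (G l) =
    - (Poly_Mapping.single (A (m + int (nat_of_num l))) 1
       - Poly_Mapping.single (A (m - int (nat_of_num l))) 1)"
| "onsager_structure (G l) (G m) = 0"

type_synonym 'k onsager = "onsager_basis \<Rightarrow>\<^sub>0 'k"

definition onsager_scale :: "'k::field \<Rightarrow> 'k onsager \<Rightarrow> 'k onsager"
  where "onsager_scale = pm_scale"

definition onsager_bracket :: "'k::field onsager \<Rightarrow> 'k onsager \<Rightarrow> 'k onsager"
  where "onsager_bracket = bilinear_extension onsager_structure"

lemma onsager_bracket_basis:
  defines "v \<equiv> \<lambda>b. Poly_Mapping.single b (1::'k::field)"
  shows "l > m \<Longrightarrow>
      onsager_bracket (v (A l)) (v (A m)) = onsager_scale 2 (v (G (num_of_nat (nat (l - m)))))"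
    and "onsager_bracket (v (G k)) (v (A m)) =
      v (A (m + int (nat_of_num k))) - v (A (m - int (nat_of_num k)))"
    and "onsager_bracket (v (G k)) (v (G n)) = 0"
  by (auto simp: v_def onsager_bracket_def onsager_scale_def bilinear_extension_single
      lookup_single when_def intro!: poly_mapping_eqI)

lemma onsager_structure_antisym: "onsager_structure a b = - onsager_structure b a"
  by (cases a; cases b) auto


section \<open>Free Lie algebras\<close>

text \<open>The free Lie algebra on \<^typ>\<open>'x\<close> is the free nonassociative algebra on \<^typ>\<open>'x\<close>, i.e. the
  algebra of the free magma, modulo the ideal generated by all squares and all Jacobi sums.\<close>

datatype 'x magma = Gen 'x | Prod "'x magma" "'x magma"

definition magma_mult :: "('x magma \<Rightarrow>\<^sub>0 'k::field) \<Rightarrow> ('x magma \<Rightarrow>\<^sub>0 'k) \<Rightarrow> ('x magma \<Rightarrow>\<^sub>0 'k)"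
  where "magma_mult = bilinear_extension (\<lambda>s t. Poly_Mapping.single (Prod s t) 1)"

interpretation magma_algebra: nonassoc_algebra pm_scale magma_mult
  unfolding magma_mult_def by (rule nonassoc_algebra_bilinear_extension)

definition lie_identities :: "('x magma \<Rightarrow>\<^sub>0 'k::field) set"
  where "lie_identities =
    {magma_mult p p | p. True} \<union>
    {magma_mult p (magma_mult q r) + magma_mult q (magma_mult r p) + magma_mult r (magma_mult p q)
      | p q r. True}"

quotient_type (overloaded) ('x, 'k) free_lie =
  "'x magma \<Rightarrow>\<^sub>0 'k::field" / "magma_algebra.cong_mod lie_identities"
  by (rule magma_algebra.equivp_cong_mod)

instantiation free_lie :: (type, field) ab_group_add
begin

lift_definition zero_free_lie :: "('a, 'b) free_lie" is 0 .

lift_definition plus_free_lie :: "('a, 'b) free_lie \<Rightarrow> ('a, 'b) free_lie \<Rightarrow> ('a, 'b) free_lie"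
  is "(+)" by (rule magma_algebra.cong_mod_add)

lift_definition minus_free_lie :: "('a, 'b) free_lie \<Rightarrow> ('a, 'b) free_lie \<Rightarrow> ('a, 'b) free_lie"
  is "(-)" by (rule magma_algebra.cong_mod_diff)

lift_definition uminus_free_lie :: "('a, 'b) free_lie \<Rightarrow> ('a, 'b) free_lie"
  is "uminus" by (rule magma_algebra.cong_mod_uminus)

instance
  by standard
    (transfer, simp add: equivp_reflp[OF magma_algebra.equivp_cong_mod] algebra_simps)+

end

lift_definition free_lie_scale :: "'k::field \<Rightarrow> ('x, 'k) free_lie \<Rightarrow> ('x, 'k) free_lie"
  is pm_scale by (rule magma_algebra.cong_mod_scale)

lift_definition free_lie_bracket ::
  "('x, 'k::field) free_lie \<Rightarrow> ('x, 'k) free_lie \<Rightarrow> ('x, 'k) free_lie"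
  is magma_mult by (rule magma_algebra.cong_mod_bracket)

lift_definition free_lie_gen :: "'x \<Rightarrow> ('x, 'k::field) free_lie"
  is "\<lambda>x. Poly_Mapping.single (Gen x) 1" .

interpretation free_lie: lie_algebra
  "free_lie_scale :: 'k::field \<Rightarrow> ('x, 'k) free_lie \<Rightarrow> ('x, 'k) free_lie" free_lie_bracket
proof
  note refl = equivp_reflp[OF magma_algebra.equivp_cong_mod]
  fix a b :: 'k and x y z :: "('x, 'k) free_lie"
  show "free_lie_scale a (x + y) = free_lie_scale a x + free_lie_scale a y"
    by transfer (simp add: refl magma_algebra.scale_right_distrib)
  show "free_lie_scale (a + b) x = free_lie_scale a x + free_lie_scale b x"
    by transfer (simp add: refl magma_algebra.scale_left_distrib)
  show "free_lie_scale a (free_lie_scale b x) = free_lie_scale (a * b) x"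
    by transfer (simp add: refl)
  show "free_lie_scale 1 x = x"
    by transfer (simp add: refl)
  show "free_lie_bracket (x + y) z = free_lie_bracket x z + free_lie_bracket y z"
    by transfer (simp add: refl magma_algebra.bracket_add_left)
  show "free_lie_bracket x (y + z) = free_lie_bracket x y + free_lie_bracket x z"
    by transfer (simp add: refl magma_algebra.bracket_add_right)
  show "free_lie_bracket (free_lie_scale a x) y = free_lie_scale a (free_lie_bracket x y)"
    by transfer (simp add: refl magma_algebra.bracket_scale_left)
  show "free_lie_bracket x (free_lie_scale a y) = free_lie_scale a (free_lie_bracket x y)"
    by transfer (simp add: refl magma_algebra.bracket_scale_right)
  show "free_lie_bracket x x = 0"
    by transfer (rule magma_algebra.cong_mod_generator, auto simp: lie_identities_def)
  show "free_lie_bracket x (free_lie_bracket y z) + free_lie_bracket y (free_lie_bracket z x) +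
      free_lie_bracket z (free_lie_bracket x y) = 0"
    by transfer (rule magma_algebra.cong_mod_generator, auto simp: lie_identities_def)
qed


section \<open>The Dolan--Grady algebra\<close>

datatype dolan_grady_gen = gen_A | gen_B

definition dolan_grady_relator ::
  "('x, 'k::field) free_lie \<Rightarrow> ('x, 'k) free_lie \<Rightarrow> ('x, 'k) free_lie"
  where "dolan_grady_relator a b =
    free_lie_bracket a (free_lie_bracket a (free_lie_bracket a b))
    - free_lie_scale 4 (free_lie_bracket a b)"

definition dolan_grady_relators :: "(dolan_grady_gen, 'k::field) free_lie set"
  where "dolan_grady_relators =
    {dolan_grady_relator (free_lie_gen gen_A) (free_lie_gen gen_B),
     dolan_grady_relator (free_lie_gen gen_B) (free_lie_gen gen_A)}"

quotient_type (overloaded) 'k dolan_grady =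
  "(dolan_grady_gen, 'k::field) free_lie" / "free_lie.cong_mod dolan_grady_relators"
  by (rule free_lie.equivp_cong_mod)

instantiation dolan_grady :: (field) ab_group_add
begin

lift_definition zero_dolan_grady :: "'a dolan_grady" is 0 .

lift_definition plus_dolan_grady :: "'a dolan_grady \<Rightarrow> 'a dolan_grady \<Rightarrow> 'a dolan_grady"
  is "(+)" by (rule free_lie.cong_mod_add)

lift_definition minus_dolan_grady :: "'a dolan_grady \<Rightarrow> 'a dolan_grady \<Rightarrow> 'a dolan_grady"
  is "(-)" by (rule free_lie.cong_mod_diff)

lift_definition uminus_dolan_grady :: "'a dolan_grady \<Rightarrow> 'a dolan_grady"
  is "uminus" by (rule free_lie.cong_mod_uminus)

instance
  by standard
    (transfer, simp add: equivp_reflp[OF free_lie.equivp_cong_mod] algebra_simps)+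

end

lift_definition dolan_grady_scale :: "'k::field \<Rightarrow> 'k dolan_grady \<Rightarrow> 'k dolan_grady"
  is free_lie_scale by (rule free_lie.cong_mod_scale)

lift_definition dolan_grady_bracket :: "'k::field dolan_grady \<Rightarrow> 'k dolan_grady \<Rightarrow> 'k dolan_grady"
  is free_lie_bracket by (rule free_lie.cong_mod_bracket)

interpretation dolan_grady: lie_algebra
  "dolan_grady_scale :: 'k::field \<Rightarrow> 'k dolan_grady \<Rightarrow> 'k dolan_grady" dolan_grady_bracket
proof
  note refl = equivp_reflp[OF free_lie.equivp_cong_mod]
  fix a b :: 'k and x y z :: "'k dolan_grady"
  show "dolan_grady_scale a (x + y) = dolan_grady_scale a x + dolan_grady_scale a y"
    by transfer (simp add: refl free_lie.scale_right_distrib)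
  show "dolan_grady_scale (a + b) x = dolan_grady_scale a x + dolan_grady_scale b x"
    by transfer (simp add: refl free_lie.scale_left_distrib)
  show "dolan_grady_scale a (dolan_grady_scale b x) = dolan_grady_scale (a * b) x"
    by transfer (simp add: refl)
  show "dolan_grady_scale 1 x = x"
    by transfer (simp add: refl)
  show "dolan_grady_bracket (x + y) z = dolan_grady_bracket x z + dolan_grady_bracket y z"
    by transfer (simp add: refl free_lie.bracket_add_left)
  show "dolan_grady_bracket x (y + z) = dolan_grady_bracket x y + dolan_grady_bracket x z"
    by transfer (simp add: refl free_lie.bracket_add_right)
  show "dolan_grady_bracket (dolan_grady_scale a x) y = dolan_grady_scale a (dolan_grady_bracket x y)"
    by transfer (simp add: refl free_lie.bracket_scale_left)
  show "dolan_grady_bracket x (dolan_grady_scale a y) = dolan_grady_scale a (dolan_grady_bracket x y)"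
    by transfer (simp add: refl free_lie.bracket_scale_right)
  show "dolan_grady_bracket x x = 0"
    by transfer (simp add: refl free_lie.bracket_self)
  show "dolan_grady_bracket x (dolan_grady_bracket y z) +
      dolan_grady_bracket y (dolan_grady_bracket z x) +
      dolan_grady_bracket z (dolan_grady_bracket x y) = 0"
    by transfer (simp add: refl free_lie.jacobi)
qed

end

theory Submission
  imports Defs
begin

text \<open>
  The isomorphism sends \<open>A 0\<close> and \<open>A 1\<close> to the two Dolan--Grady generators. That the Dolan--Grady
  algebra maps back to the Onsager algebra is a matter of verifying the two relations there
  (\<open>onsager_dolan_grady_relations\<close>) and of the universal property of a presented algebra
  (\<open>dolan_grady_universal\<close>). The substance is the opposite direction: two relations in two
  generators must imply all the Onsager relations.

  Let \<open>x\<close>, \<open>y\<close> satisfy the Dolan--Grady relations in a Lie algebra of characteristic zero, and let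
  \<open>g = [y, x] / 2\<close>. The recurrence \<open>[g, a m] = a (m + 1) - a (m - 1)\<close> extends \<open>a 0 = x\<close>, \<open>a 1 = y\<close> to
  a sequence over the integers, and the two relations say precisely that
  \<open>[a 0, a (-1)] = [a 1, a 0] = [a 2, a 1] = 2 g\<close>.

  The first difficulty is to propagate this to \<open>[a (m + 1), a m] = 2 g\<close> for every \<open>m\<close>. It suffices
  to reach \<open>[a 3, a 2]\<close> (\<open>next_neighbour_bracket\<close>), since the recurrence is invariant under shifts
  and under the reflection \<open>m \<mapsto> - m\<close>, \<open>g \<mapsto> - g\<close>.

  The second is to show by induction on \<open>n\<close> that \<open>[a (m + n), a m]\<close> depends on \<open>n\<close> only
  (\<open>relations_nat\<close>). Let \<open>h n\<close> be its value for a given \<open>n\<close>. Applying \<open>ad g\<close> to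
  \<open>[a (m + n), a m]\<close> shows that \<open>X m = [a (m + n + 1), a m]\<close> is an arithmetic progression with
  difference \<open>c = [g, h n]\<close>. On the other hand \<open>[h n, [a 1, a 0]]\<close> equals \<open>- 2 c\<close> because
  \<open>[a 1, a 0] = 2 g\<close>, and equals \<open>2 (X 0 - X (- n)) = 2 n c\<close> by the derivation rule. Hence
  \<open>(2 n + 2) c = 0\<close>; so \<open>c = 0\<close> in characteristic zero, and \<open>X\<close> is constant. The remaining relations
  follow from the Jacobi identity.

  The resulting homomorphism from the Onsager algebra is surjective because its image contains the
  generators, and injective because composing it with the map back fixes every basis element.
\<close>

section \<open>Lie sequences satisfying the Onsager recurrence\<close>

context lie_algebra
begin

lemma bracket_swap: "bracket y x = - bracket x y"
proof -
  have "bracket (x + y) (x + y) = 0" by (rule bracket_self)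
  then have "bracket x y + bracket y x = 0"
    unfolding bracket_add_left bracket_add_right by (simp add: bracket_self add.commute)
  then show ?thesis by (simp add: eq_neg_iff_add_eq_0 add.commute)
qed

text \<open>The Jacobi identity in the form in which it is used below: \<open>ad d\<close> is a derivation.\<close>

lemma bracket_derivation:
  "bracket d (bracket x y) = bracket (bracket d x) y + bracket x (bracket d y)"
proof -
  have "bracket d (bracket x y) = - bracket x (bracket y d) - bracket y (bracket d x)"
    using jacobi[of d x y] by (simp add: eq_neg_iff_add_eq_0 algebra_simps)
  moreover have "bracket x (bracket y d) = - bracket x (bracket d y)"
    by (simp add: bracket_swap[of y d] bracket_minus_right)
  moreover have "bracket y (bracket d x) = - bracket (bracket d x) y"
    by (rule bracket_swap)
  ultimately show ?thesis by simp
qed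

lemma bracket_derivation_right:
  "bracket (bracket x y) z = bracket (bracket x z) y + bracket x (bracket y z)"
proof -
  have "- bracket (bracket x y) z = - (bracket (bracket x z) y + bracket x (bracket y z))"
    using bracket_derivation[of z x y]
    by (simp add: bracket_swap[of z] bracket_minus_left bracket_minus_right)
  then show ?thesis
    by (simp only: neg_equal_iff_equal)
qed

end

locale lie_algebra_char_0 = lie_algebra scale bracket
  for scale :: "'k::field_char_0 \<Rightarrow> 'a::ab_group_add \<Rightarrow> 'a" and bracket

text \<open>Solutions of \<open>[G 1, A m] = A (m + 1) - A (m - 1)\<close>, the one Onsager relation that determines all
  \<open>A m\<close> from two neighbours and \<open>G 1\<close>.\<close>

locale onsager_recurrence = lie_algebra_char_0 scale bracket
  for scale :: "'k::field_char_0 \<Rightarrow> 'a::ab_group_add \<Rightarrow> 'a" and bracket +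
  fixes g :: 'a and a :: "int \<Rightarrow> 'a"
  assumes g_a: "bracket g (a m) = a (m + 1) - a (m - 1)"
begin

text \<open>This second-order difference operator is what makes \<open>ad g\<close> move brackets of the sequence from
  one index difference to the next.\<close>

lemma g_bracket:
  "bracket g (bracket (a l) (a m)) =
     bracket (a (l + 1)) (a m) - bracket (a (l - 1)) (a m)
     + bracket (a l) (a (m + 1)) - bracket (a l) (a (m - 1))"
  by (simp add: bracket_derivation g_a bracket_diff_left bracket_diff_right)

lemma shift: "onsager_recurrence scale bracket g (\<lambda>m. a (m + k))"
  by unfold_locales (simp add: g_a algebra_simps)

lemma reflect: "onsager_recurrence scale bracket (- g) (\<lambda>m. a (- m))"
  by unfold_locales (simp add: g_a bracket_minus_left algebra_simps)

lemma scale_g_a: "bracket (scale c g) (a m) = scale c (a (m + 1) - a (m - 1))"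
  by (simp add: bracket_scale_left g_a)

lemma scale_of_nat_eq_0: "scale (of_nat n) x = 0 \<longleftrightarrow> n = 0 \<or> x = 0"
  by (simp add: scale_eq_0_iff)

text \<open>Besides \<open>[a 2, a 1] = 2 g\<close>, information is carried by \<open>U = [a 2, a 0]\<close>, which plays the role of
  \<open>2 G 2\<close>. Since \<open>ad g\<close> kills \<open>g\<close>, the recurrence shows that \<open>U\<close> is also \<open>[a 1, a (-1)]\<close> and
  \<open>[a 3, a 1]\<close>, and the Jacobi identity gives its brackets with \<open>a 0\<close> and \<open>a 1\<close>. Since
  \<open>[g, U] = c\<close> is the common difference of \<open>[a 1, a (-2)]\<close>, \<open>[a 2, a (-1)]\<close>, \<open>[a 3, a 0]\<close>, computing
  \<open>[U, 2 g]\<close> in two ways gives \<open>- 2 c = 4 c\<close>, so \<open>c = 0\<close>. Knowing this, both \<open>[U, [a 2, a 1]]\<close> and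
  \<open>[g, [a 3, a 1]]\<close> vanish; expanded, they are two linear equations in the unknown brackets
  \<open>[a 4, a 1]\<close>, \<open>[a 3, a 0]\<close> and \<open>[a 3, a 2]\<close>, and their difference is \<open>2 [a 3, a 2] = 4 g\<close>.\<close>

lemma next_neighbour_bracket:
  assumes T0: "bracket (a 0) (a (- 1)) = scale 2 g"
    and T1: "bracket (a 1) (a 0) = scale 2 g"
    and T2: "bracket (a 2) (a 1) = scale 2 g"
  shows "bracket (a 3) (a 2) = scale 2 g"
proof -
  define T where "T = scale 2 g"
  note T = T0[folded T_def] T1[folded T_def] T2[folded T_def]
  have T': "bracket (a (-1)) (a 0) = - T" "bracket (a 0) (a 1) = - T" "bracket (a 1) (a 2) = - T"
    using T bracket_swap by metis+
  have gT: "bracket g T = 0"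
    by (simp add: T_def bracket_scale_right bracket_self)
  have Ta: "bracket T (a m) = scale 2 (a (m + 1) - a (m - 1))"
    and aT: "bracket (a m) T = - scale 2 (a (m + 1) - a (m - 1))" for m
    using bracket_swap[of "a m" T] by (simp_all add: T_def scale_g_a)
  define U where "U = bracket (a 2) (a 0)"
  have U1: "bracket (a 1) (a (-1)) = U"
    using g_bracket[of 1 0] by (simp add: T gT bracket_self U_def)
  have U2: "bracket (a 3) (a 1) = U"
    using g_bracket[of 2 1] by (simp add: T gT bracket_self U_def)
  have Ua1: "bracket U (a 1) = scale 2 (a 3 - a (-1))"
    unfolding U_def bracket_derivation_right[of _ _ "a 1"] T T'
    by (simp add: bracket_minus_right Ta aT flip: scale_right_distrib)
  have Ua0: "bracket U (a 0) = scale 2 (a 2 - a (-2))"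
    unfolding U1[symmetric] bracket_derivation_right[of _ _ "a 0"] T T'
    by (simp add: bracket_minus_right Ta aT flip: scale_right_distrib)
  define c where "c = bracket g U"
  define V where "V = bracket (a 3) (a 0)"
  define V' where "V' = bracket (a 2) (a (-1))"
  define V'' where "V'' = bracket (a 1) (a (-2))"
  have c1: "c = V - V'"
    using g_bracket[of 2 0] by (simp add: T U_def c_def V_def V'_def)
  have c2: "c = V' - V''"
    using g_bracket[of 1 "-1"] by (simp add: T U1 c_def V'_def V''_def)
  have "c = 0"
  proof -
    have "- scale 2 c = bracket U T"
      using bracket_swap[of U g] by (simp add: T_def c_def bracket_scale_right)
    also have "\<dots> = scale 2 (V - V'')"
      unfolding T(2)[symmetric] bracket_derivation[of U] Ua1 Ua0
      by (simp add: bracket_scale_left bracket_scale_right bracket_diff_left bracket_diff_right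
          T T' V_def V''_def algebra_simps)
    also have "V - V'' = (V - V') + (V' - V'')"
      by simp
    also have "\<dots> = c + c"
      using c1 c2 by simp
    finally have *: "- scale 2 c = scale 2 (c + c)" .
    have "scale 6 c = scale 2 (c + c) + scale 2 c"
      by (simp add: scale_right_distrib flip: scale_left_distrib)
    also have "\<dots> = 0"
      by (simp flip: *)
    finally show ?thesis
      using scale_of_nat_eq_0[of 6 c] by simp
  qed
  then have "V' = V"
    using c1 by simp
  have UT: "bracket U T = 0"
    using \<open>c = 0\<close> bracket_swap[of U g] by (simp add: T_def c_def bracket_scale_right)
  have Ua2: "bracket U (a 2) = scale 2 (a 4 - a 0)"
  proof -
    \<comment> \<open>As \<open>U\<close> and \<open>g\<close> commute, \<open>ad U\<close> respects the recurrence that leads from \<open>a 0\<close> and \<open>a 1\<close> to \<open>a 2\<close>.\<close>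
    have "bracket U (bracket g (a 1)) = bracket g (bracket U (a 1))"
      using \<open>c = 0\<close> bracket_derivation[of g U "a 1"] by (simp add: c_def)
    then have "bracket U (a 2) - bracket U (a 0) = scale 2 (a 4 - a 2) - scale 2 (a 0 - a (-2))"
      by (simp add: g_a Ua1 bracket_scale_right bracket_diff_right flip: scale_right_diff_distrib)
    then show ?thesis
      unfolding Ua0 by (simp add: algebra_simps)
  qed
  define W where "W = bracket (a 4) (a 1)"
  define X where "X = bracket (a 3) (a 2)"
  have "W - V + T - X = 0"
  proof -
    have "scale 2 (W - V + T - X) = bracket U (bracket (a 2) (a 1))"
      unfolding bracket_derivation[of U] Ua1 Ua2 using bracket_swap[of "a 2" "a 3"]
      by (simp add: bracket_scale_left bracket_scale_right bracket_diff_left bracket_diff_right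
          T T' V'_def[symmetric] \<open>V' = V\<close> W_def X_def algebra_simps)
    then show ?thesis
      using scale_of_nat_eq_0[of 2 "W - V + T - X"] by (simp add: T UT)
  qed
  moreover have "W - T + X - V = 0"
    using g_bracket[of 3 1] \<open>c = 0\<close> by (simp add: U2 T W_def X_def V_def c_def)
  moreover have "scale 2 (X - T) = (W - T + X - V) - (W - V + T - X)"
    using scale_left_distrib[of 1 1 "X - T"] by simp
  ultimately have "scale 2 (X - T) = 0"
    by simp
  then show ?thesis
    using scale_of_nat_eq_0[of 2 "X - T"] by (simp add: X_def T_def)
qed

lemma neighbour_bracket_up:
  assumes "bracket (a (m + 1)) (a m) = scale 2 g"
    and "bracket (a (m + 2)) (a (m + 1)) = scale 2 g"
    and "bracket (a (m + 3)) (a (m + 2)) = scale 2 g"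
  shows "bracket (a (m + 4)) (a (m + 3)) = scale 2 g"
proof -
  interpret s: onsager_recurrence scale bracket g "\<lambda>i. a (i + (m + 1))"
    by (rule shift)
  show ?thesis
    using s.next_neighbour_bracket assms by (simp add: algebra_simps)
qed

text \<open>Reflection reverses the order of neighbours and the sign of \<open>g\<close>, so the upward step for the reflected
  sequence is the downward step for the given one.\<close>

lemma neighbour_bracket_down:
  assumes "bracket (a (m + 1)) (a m) = scale 2 g"
    and "bracket (a (m + 2)) (a (m + 1)) = scale 2 g"
    and "bracket (a (m + 3)) (a (m + 2)) = scale 2 g"
  shows "bracket (a m) (a (m - 1)) = scale 2 g"
proof -
  interpret r: onsager_recurrence scale bracket "- g" "\<lambda>i. a (- i)"
    by (rule reflect)
  have "bracket (a (m - 1)) (a m) = - scale 2 g"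
    using r.neighbour_bracket_up[of "- m - 3"] assms
      bracket_swap[of "a m" "a (m + 1)"] bracket_swap[of "a (m + 1)" "a (m + 2)"]
      bracket_swap[of "a (m + 2)" "a (m + 3)"]
    by (simp add: algebra_simps)
  then show ?thesis
    using bracket_swap[of "a m" "a (m - 1)"] by simp
qed

lemma neighbour_bracket:
  assumes "bracket (a 0) (a (- 1)) = scale 2 g"
    and "bracket (a 1) (a 0) = scale 2 g"
    and "bracket (a 2) (a 1) = scale 2 g"
  shows "bracket (a (m + 1)) (a m) = scale 2 g"
proof -
  define P where "P m \<longleftrightarrow> bracket (a (m + 1)) (a m) = scale 2 g" for m
  have "P m \<and> P (m + 1) \<and> P (m + 2)" for m
  proof (induction m rule: int_induct[where k = "- 1"])
    case base
    then show ?case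
      using assms by (simp add: P_def)
  next
    case (step1 i)
    then show ?case
      using neighbour_bracket_up[of i] by (simp add: P_def algebra_simps)
  next
    case (step2 i)
    then show ?case
      using neighbour_bracket_down[of i] by (simp add: P_def algebra_simps)
  qed
  then show ?thesis
    by (simp add: P_def)
qed

end

locale onsager_sequence = onsager_recurrence +
  assumes neighbour: "bracket (a (m + 1)) (a m) = scale 2 g"
begin

text \<open>The element \<open>h n\<close> stands for \<open>2 G n\<close>, extended to all integers as an odd function of \<open>n\<close>; this
  avoids case distinctions on the order of the indices.\<close>

definition h :: "int \<Rightarrow> 'b"
  where "h n = bracket (a n) (a 0)"

definition relations_at :: "int \<Rightarrow> bool"
  where "relations_at n \<longleftrightarrow> (\<forall>m. bracket (a (m + n)) (a m) = h n \<and>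
    bracket (h n) (a m) = scale 2 (a (m + n) - a (m - n)))"

text \<open>The step needs the relations at \<open>n\<close> and at \<open>n - 1\<close>, since the operator of \<open>g_bracket\<close> couples
  three consecutive index differences.\<close>

lemma relations_nat: "relations_at (int k) \<and> relations_at (int k + 1)"
proof (induction k)
  case 0
  have "h 1 = scale 2 g"
    using neighbour[of 0] by (simp add: h_def)
  then show ?case
    using neighbour by (simp add: relations_at_def h_def bracket_self scale_g_a)
next
  case (Suc k)
  define n where "n = int k + 1"
  have IH: "bracket (a (m + n)) (a m) = h n" "bracket (a (m + n - 1)) (a m) = h (n - 1)"
    "bracket (h n) (a m) = scale 2 (a (m + n) - a (m - n))" for m
  proof -
    have "relations_at n" "relations_at (n - 1)"
      using Suc by (simp_all add: n_def)
    then show "bracket (a (m + n)) (a m) = h n" "bracket (a (m + n - 1)) (a m) = h (n - 1)"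
      "bracket (h n) (a m) = scale 2 (a (m + n) - a (m - n))"
      unfolding relations_at_def add_diff_eq by blast+
  qed
  define X where "X m = bracket (a (m + n + 1)) (a m)" for m
  define c where "c = bracket g (h n)"
  have X_step: "X m - X (m - 1) = c" for m
  proof -
    have "c = bracket g (bracket (a (m + n)) (a m))"
      by (simp add: c_def IH)
    also have "\<dots> = X m - X (m - 1)"
      using IH(2)[of m] IH(2)[of "m + 1"] unfolding g_bracket by (simp add: X_def algebra_simps)
    finally show ?thesis ..
  qed
  have X_nat: "X m - X (m - int i) = scale (of_nat i) c" for m i
  proof (induction i)
    case (Suc i)
    have "X m - X (m - int (Suc i)) = (X m - X (m - int i)) + (X (m - int i) - X (m - int i - 1))"
      by (simp add: algebra_simps)
    then show ?case
      unfolding Suc X_step by (simp add: algebra_simps)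
  qed simp
  have "c = 0"
  proof -
    have "- scale 2 c = bracket (h n) (bracket (a 1) (a 0))"
      using neighbour[of 0] bracket_swap[of "h n" g] by (simp add: c_def bracket_scale_right)
    also have "\<dots> = scale 2 (X 0 - X (0 - n))"
    proof -
      have "bracket (a 1) (a n) = - h (n - 1)" "bracket (a (1 - n)) (a 0) = - h (n - 1)"
        using IH(2)[of 1] IH(2)[of "1 - n"] bracket_swap[of "a 1" "a n"]
          bracket_swap[of "a (1 - n)" "a 0"] by simp_all
      then show ?thesis
        unfolding bracket_derivation[of "h n"] IH(3)
        by (simp add: X_def bracket_scale_left bracket_scale_right bracket_diff_left
            bracket_diff_right algebra_simps)
    qed
    also have "X 0 - X (0 - n) = scale (of_nat (Suc k)) c"
      using X_nat[of 0 "Suc k"] by (simp add: n_def algebra_simps)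
    finally have *: "- scale 2 c = scale 2 (scale (of_nat (Suc k)) c)" .
    have "scale (of_nat (2 * Suc k + 2)) c = scale (2 * of_nat (Suc k) + 2) c"
      by simp
    also have "\<dots> = scale 2 (scale (of_nat (Suc k)) c) + scale 2 c"
      by (simp only: scale_left_distrib scale_scale)
    also have "\<dots> = 0"
      unfolding *[symmetric] by simp
    finally show ?thesis
      unfolding scale_of_nat_eq_0 by simp
  qed
  \<comment> \<open>The difference of the progression vanishes, so \<open>X\<close> is constant and may be called \<open>h (n + 1)\<close>.\<close>
  have "X m = X 0" for m
  proof (induction m rule: int_induct[where k = 0])
    case (step1 i)
    then show ?case
      using X_step[of "i + 1"] \<open>c = 0\<close> by simp
  next
    case (step2 i)
    then show ?case
      using X_step[of i] \<open>c = 0\<close> by simp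
  qed simp
  then have R2: "bracket (a (m + n + 1)) (a m) = h (n + 1)" for m
    by (simp add: X_def h_def)
  have R4: "bracket (h (n + 1)) (a m) = scale 2 (a (m + n + 1) - a (m - n - 1))" for m
  proof -
    \<comment> \<open>Among the representations of \<open>h (n + 1)\<close> choose the one ending in \<open>a (m - 1)\<close>: the Jacobi identity
      then splits its bracket with \<open>a m\<close> into brackets of \<open>h n\<close> and of \<open>2 g\<close>.\<close>
    have "bracket (a m) (a (m - 1)) = scale 2 g"
      using neighbour[of "m - 1"] by simp
    then have "bracket (a (m - 1)) (a m) = - scale 2 g"
      by (metis bracket_swap)
    moreover have "bracket (a (m + n)) (a m) = h n"
      by (rule IH)
    ultimately have "bracket (bracket (a (m + n)) (a (m - 1))) (a m) =
        bracket (h n) (a (m - 1)) + bracket (scale 2 g) (a (m + n))"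
      by (simp add: bracket_derivation_right[of _ _ "a m"] bracket_minus_right
          bracket_swap[of "a (m + n)" "scale 2 g"])
    then show ?thesis
      using R2[of "m - 1"] unfolding IH(3) scale_g_a by (simp add: algebra_simps)
  qed
  show ?case
    using IH(1,3) R2 R4 by (simp add: n_def relations_at_def algebra_simps)
qed

lemma h_minus: "h (- n) = - h n"
proof -
  have "h (- int k) = - h (int k)" for k
  proof -
    have "bracket (a (- int k + int k)) (a (- int k)) = h (int k)"
      using relations_nat[of k] unfolding relations_at_def by blast
    then show ?thesis
      using bracket_swap[of "a (- int k)" "a 0"] by (simp add: h_def)
  qed
  from this[of "nat n"] this[of "nat (- n)"] show ?thesis
    by (cases "n \<ge> 0") simp_all
qed

lemma relations: "relations_at n"
proof (cases "n \<ge> 0")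
  case True
  then show ?thesis
    using relations_nat[of "nat n"] by simp
next
  case False
  then have "relations_at (- n)"
    using relations_nat[of "nat (- n)"] by simp
  then have *: "bracket (a (m - n)) (a m) = - h n"
    "bracket (h n) (a m) = - scale 2 (a (m - n) - a (m + n))" for m
    by (simp_all add: relations_at_def h_minus bracket_minus_left minus_equation_iff[of _ "scale _ _"])
  have "bracket (a (m + n)) (a m) = h n" for m
    using *(1)[of "m + n"] bracket_swap[of "a (m + n)" "a m"] by simp
  with * show ?thesis
    by (simp add: relations_at_def scale_right_diff_distrib)
qed

lemma bracket_a_a: "bracket (a l) (a m) = h (l - m)"
proof -
  have "bracket (a (m + (l - m))) (a m) = h (l - m)"
    using relations unfolding relations_at_def by blast
  then show ?thesis by simp
qed

lemma bracket_h_a: "bracket (h n) (a m) = scale 2 (a (m + n) - a (m - n))"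
  using relations unfolding relations_at_def by blast

lemma bracket_a_h: "bracket (a m) (h n) = scale 2 (a (m - n) - a (m + n))"
  using bracket_h_a[of n m] bracket_swap[of "a m" "h n"] by (simp add: scale_right_diff_distrib)

text \<open>Written as \<open>[a m, a 0]\<close>, the element \<open>h m\<close> has a bracket with \<open>h l\<close> whose four terms cancel in pairs
  because \<open>h\<close> is odd.\<close>

lemma bracket_h_h: "bracket (h l) (h m) = 0"
proof -
  have "bracket (h l) (bracket (a m) (a 0)) = 0"
    using h_minus[of "m + l"] h_minus[of "m - l"]
    unfolding bracket_derivation[of "h l"] bracket_h_a
    by (simp add: bracket_scale_left bracket_scale_right bracket_diff_left bracket_diff_right
        bracket_a_a algebra_simps)
  then show ?thesis
    by (simp add: bracket_a_a)
qed

end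

fun two_step_seq :: "('a::ab_group_add \<Rightarrow> 'a) \<Rightarrow> 'a \<Rightarrow> 'a \<Rightarrow> nat \<Rightarrow> 'a" where
  "two_step_seq d x y 0 = x"
| "two_step_seq d x y (Suc 0) = y"
| "two_step_seq d x y (Suc (Suc n)) = two_step_seq d x y n + d (two_step_seq d x y (Suc n))"

context lie_algebra_char_0
begin

text \<open>The recurrence can be solved in both directions: upwards from \<open>x, y\<close>, and downwards from \<open>y, x\<close>
  after changing the sign of \<open>g\<close>. The two branches overlap at the indices 0 and 1.\<close>

lemma onsager_recurrence_exists:
  "\<exists>a. onsager_recurrence scale bracket g a \<and> a 0 = x \<and> a 1 = y"
proof -
  define a where "a m = (if m \<ge> 0 then two_step_seq (bracket g) x y (nat m)
    else two_step_seq (\<lambda>z. - bracket g z) y x (nat (1 - m)))" for m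
  have "bracket g (a m) = a (m + 1) - a (m - 1)" for m
  proof -
    consider k where "m = int (Suc k)" | "m = 0" | k where "m = - int (Suc k)"
    proof (cases m rule: int_cases3)
      case (pos n)
      then show ?thesis using that(1)[of "n - 1"] by simp
    next
      case (neg n)
      then show ?thesis using that(3)[of "n - 1"] by simp
    qed (use that in simp)
    then show ?thesis
    proof cases
      case (1 k)
      then have "nat m = Suc k" "nat (m + 1) = Suc (Suc k)" "nat (m - 1) = k"
        by simp_all
      then show ?thesis using 1 by (simp add: a_def)
    next
      case 2
      then show ?thesis by (simp add: a_def numeral_2_eq_2)
    next
      case (3 k)
      then have "nat (1 - m) = Suc (Suc k)" "nat (1 - (m - 1)) = Suc (Suc (Suc k))"
        "nat (1 - (m + 1)) = Suc k"
        by simp_all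
      moreover have "a (m + 1) = two_step_seq (\<lambda>z. - bracket g z) y x (Suc k)"
        using 3 by (cases "k = 0") (simp_all add: a_def nat_add_distrib)
      ultimately show ?thesis using 3 by (simp add: a_def)
    qed
  qed
  then have "onsager_recurrence scale bracket g a"
    by unfold_locales
  moreover have "a 0 = x" "a 1 = y"
    by (simp_all add: a_def)
  ultimately show ?thesis by blast
qed

text \<open>With \<open>g = [y, x] / 2\<close> each of the two relations computes one further neighbour bracket:
  \<open>[x, [g, x]] = 2 [x, y]\<close> amounts to \<open>[a 0, a (-1)] = 2 g\<close>, and \<open>[y, [g, y]] = - 2 [y, x]\<close> amounts
  to \<open>[a 2, a 1] = 2 g\<close>.\<close>

lemma onsager_sequence_exists:
  assumes xy: "bracket x (bracket x (bracket x y)) = scale 4 (bracket x y)"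
    and yx: "bracket y (bracket y (bracket y x)) = scale 4 (bracket y x)"
  shows "\<exists>g a. onsager_sequence scale bracket g a \<and> a 0 = x \<and> a 1 = y"
proof -
  define g where "g = scale (1 / 2) (bracket y x)"
  have T: "scale 2 g = bracket y x"
    by (simp add: g_def)
  obtain a where "onsager_recurrence scale bracket g a" and a: "a 0 = x" "a 1 = y"
    using onsager_recurrence_exists by blast
  then interpret onsager_recurrence scale bracket g a by simp
  have "bracket x (bracket g x) = scale 2 (bracket x y)"
  proof -
    have "bracket (bracket y x) x = bracket x (bracket x y)"
      unfolding bracket_swap[of "bracket y x" x]
      by (simp add: bracket_swap[of y x] bracket_minus_right)
    then have "bracket g x = scale (1 / 2) (bracket x (bracket x y))"
      by (simp add: g_def bracket_scale_left)
    then show ?thesis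
      by (simp add: bracket_scale_right xy)
  qed
  moreover have "bracket g x = y - a (- 1)"
    using g_a[of 0] by (simp add: a)
  ultimately have "bracket x y - bracket x (a (- 1)) = scale (1 + 1) (bracket x y)"
    by (simp add: bracket_diff_right)
  then have 0: "bracket (a 0) (a (- 1)) = scale 2 g"
    unfolding scale_left_distrib T a using bracket_swap[of x y] by (simp add: algebra_simps)
  have "bracket y (bracket g y) = - scale 2 (bracket y x)"
  proof -
    have "bracket g y = - scale (1 / 2) (bracket y (bracket y x))"
      using bracket_swap[of "bracket y x" y]
      by (simp add: g_def bracket_scale_left)
    then show ?thesis
      by (simp add: bracket_scale_right bracket_minus_right yx)
  qed
  moreover have "bracket g y = a 2 - x"
    using g_a[of 1] by (simp add: a)
  ultimately have "bracket y (a 2) - bracket y x = - scale (1 + 1) (bracket y x)"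
    by (simp add: bracket_diff_right)
  then have 2: "bracket (a 2) (a 1) = scale 2 g"
    unfolding scale_left_distrib T a using bracket_swap[of y "a 2"] by (simp add: algebra_simps)
  have "onsager_sequence scale bracket g a"
    by unfold_locales (rule neighbour_bracket[OF 0 _ 2], simp add: a T)
  then show ?thesis using a by blast
qed

end

lemma onsager_recurrence_unique:
  assumes "onsager_recurrence s br g a" "onsager_recurrence s br g b" and "a 0 = b 0" "a 1 = b 1"
  shows "a m = b m"
proof -
  interpret a: onsager_recurrence s br g a by fact
  interpret b: onsager_recurrence s br g b by fact
  have "a m = b m \<and> a (m + 1) = b (m + 1)"
  proof (induction m rule: int_induct[where k = 0])
    case (step1 i)
    then show ?case
      using a.g_a[of "i + 1"] b.g_a[of "i + 1"] by (simp add: algebra_simps)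
  next
    case (step2 i)
    then show ?case
      using a.g_a[of i] b.g_a[of i] by simp
  qed (simp add: assms)
  then show ?thesis ..
qed

section \<open>Linear maps given on a basis\<close>

definition linear_extension ::
  "('k::field \<Rightarrow> 'v::ab_group_add \<Rightarrow> 'v) \<Rightarrow> ('b \<Rightarrow> 'v) \<Rightarrow> ('b \<Rightarrow>\<^sub>0 'k) \<Rightarrow> 'v"
  where "linear_extension s f p =
    (\<Sum>b\<in>Poly_Mapping.keys p. s (Poly_Mapping.lookup p b) (f b))"

lemma linear_extension_single:
  assumes "vector_space s"
  shows "linear_extension s f (Poly_Mapping.single b 1) = f b"
proof -
  interpret vector_space s by fact
  show ?thesis by (simp add: linear_extension_def)
qed

lemma linear_linear_extension:
  assumes "vector_space s"
  shows "Vector_Spaces.linear pm_scale s (linear_extension s f)"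
proof -
  interpret vector_space s by fact
  interpret pm: vector_space "pm_scale :: 'a \<Rightarrow> ('c \<Rightarrow>\<^sub>0 'a) \<Rightarrow> _"
    by (rule vector_space_pm_scale)
  have superset: "linear_extension s f p = (\<Sum>b\<in>B. s (Poly_Mapping.lookup p b) (f b))"
    if "finite B" "Poly_Mapping.keys p \<subseteq> B" for p B
    unfolding linear_extension_def
    by (intro sum.mono_neutral_left) (use that in \<open>auto simp: in_keys_iff\<close>)
  show ?thesis
  proof
    fix p q :: "'c \<Rightarrow>\<^sub>0 'a" and c :: 'a
    let ?B = "Poly_Mapping.keys p \<union> Poly_Mapping.keys q"
    have "Poly_Mapping.keys (p + q) \<subseteq> ?B"
      by (rule keys_add)
    then show "linear_extension s f (p + q) = linear_extension s f p + linear_extension s f q"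
      by (simp add: superset[of ?B] lookup_add scale_left_distrib sum.distrib)
    have "Poly_Mapping.keys (pm_scale c p) \<subseteq> Poly_Mapping.keys p"
      by (auto simp: in_keys_iff)
    then show "linear_extension s f (pm_scale c p) = s c (linear_extension s f p)"
      by (simp add: superset[of "Poly_Mapping.keys p"] scale_sum_right)
  qed
qed

text \<open>A property closed under linear combinations holds everywhere once it holds on the basis.\<close>

lemma pm_basis_induct [case_names zero basis add scale]:
  assumes zero: "P 0"
    and basis: "\<And>b. P (Poly_Mapping.single b (1::'k::field))"
    and add: "\<And>p q. P p \<Longrightarrow> P q \<Longrightarrow> P (p + q)"
    and scale: "\<And>c p. P p \<Longrightarrow> P (pm_scale c p)"
  shows "P p"
proof (induction p rule: update_induct)
  case const
  show ?case by (rule zero)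
next
  case (update f a b)
  have "Poly_Mapping.update a b f = f + pm_scale b (Poly_Mapping.single a 1)"
    by (rule poly_mapping_eqI)
      (use update.hyps in \<open>auto simp: lookup_update lookup_add lookup_single in_keys_iff when_def\<close>)
  then show ?case
    using add[OF update.IH scale[OF basis]] by simp
qed

lemma bilinear_extension_hom:
  assumes "nonassoc_algebra s br" and "Vector_Spaces.linear pm_scale s F"
    and basis: "\<And>a b. F (m a b) = br (F (Poly_Mapping.single a 1)) (F (Poly_Mapping.single b 1))"
  shows "F (bilinear_extension m p q) = br (F p) (F q)"
proof -
  interpret nonassoc_algebra s br by fact
  interpret F: Vector_Spaces.linear pm_scale s F by fact
  interpret m: nonassoc_algebra pm_scale "bilinear_extension m"
    by (rule nonassoc_algebra_bilinear_extension)
  show ?thesis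
  proof (induction p rule: pm_basis_induct)
    case (basis a)
    show ?case
      by (induction q rule: pm_basis_induct)
        (simp_all add: bilinear_extension_single assms(3) m.bracket_add_right m.bracket_scale_right
          bracket_add_right bracket_scale_right F.add F.scale)
  qed (simp_all add: m.bracket_add_left m.bracket_scale_left
      bracket_add_left bracket_scale_left F.add F.scale)
qed

text \<open>The kernel of a homomorphism is an ideal, so it contains the ideal generated by any of its
  subsets.\<close>

lemma hom_eq_if_cong_mod:
  assumes "nonassoc_algebra s br" "nonassoc_algebra s' br'" "Vector_Spaces.linear s s' f"
    and mult: "\<And>x y. f (br x y) = br' (f x) (f y)"
    and S: "\<And>x. x \<in> S \<Longrightarrow> f x = 0"
    and cong: "nonassoc_algebra.cong_mod s br S x y"
  shows "f x = f y"
proof -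
  interpret nonassoc_algebra s br by fact
  interpret t: nonassoc_algebra s' br' by fact
  interpret Vector_Spaces.linear s s' f by fact
  have "ideal {x. f x = 0}"
    by (auto simp: ideal_def subspace_def add scale mult)
  then have "ideal_generated S \<subseteq> {x. f x = 0}"
    unfolding ideal_generated_def using S by (intro hull_minimal) auto
  then show ?thesis
    using cong by (auto simp: cong_mod_def diff)
qed

section \<open>Universal properties of the free Lie algebra and the Dolan--Grady algebra\<close>

primrec magma_eval :: "('v \<Rightarrow> 'v \<Rightarrow> 'v) \<Rightarrow> ('x \<Rightarrow> 'v) \<Rightarrow> 'x magma \<Rightarrow> 'v" where
  "magma_eval br h (Gen x) = h x"
| "magma_eval br h (Prod s t) = br (magma_eval br h s) (magma_eval br h t)"

text \<open>The map on generators extends to the free magma by recursion, to the free nonassociative algebra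
  by linearity, and passes to the quotient because the target satisfies the identities that are
  divided out.\<close>

lemma free_lie_universal:
  fixes h :: "'x \<Rightarrow> 'v::ab_group_add"
  assumes "lie_algebra s br"
  shows "\<exists>F. lie_algebra_hom free_lie_scale free_lie_bracket s br F \<and> (\<forall>x. F (free_lie_gen x) = h x)"
proof -
  interpret lie_algebra s br by fact
  define E where "E = linear_extension s (magma_eval br h)"
  interpret E: Vector_Spaces.linear pm_scale s E
    unfolding E_def by (rule linear_linear_extension) unfold_locales
  have E_single: "E (Poly_Mapping.single t 1) = magma_eval br h t" for t
    unfolding E_def by (rule linear_extension_single) unfold_locales
  have E_mult: "E (magma_mult p q) = br (E p) (E q)" for p q
    unfolding magma_mult_def
    by (rule bilinear_extension_hom) (unfold_locales, simp add: E_single)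
  have E_cong: "E p = E q" if "magma_algebra.cong_mod lie_identities p q" for p q
    by (rule hom_eq_if_cong_mod[where f = E, OF _ _ _ _ _ that])
      (unfold_locales, auto simp: lie_identities_def E.add E_mult bracket_self jacobi)
  define F where "F z = E (rep_free_lie z)" for z
  have F_abs: "F (abs_free_lie p) = E p" for p
    unfolding F_def
    by (intro E_cong Quotient3_rep_abs[OF Quotient3_free_lie] equivp_reflp[OF magma_algebra.equivp_cong_mod])
  have "lie_algebra_hom free_lie_scale free_lie_bracket s br F"
  proof
    fix x y c
    show "F (x + y) = F x + F y"
      by (induction x rule: free_lie.abs_induct; induction y rule: free_lie.abs_induct)
        (simp add: plus_free_lie.abs_eq F_abs E.add)
    show "F (free_lie_scale c x) = s c (F x)"
      by (induction x rule: free_lie.abs_induct) (simp add: free_lie_scale.abs_eq F_abs E.scale)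
    show "F (free_lie_bracket x y) = br (F x) (F y)"
      by (induction x rule: free_lie.abs_induct; induction y rule: free_lie.abs_induct)
        (simp add: free_lie_bracket.abs_eq F_abs E_mult)
  qed
  moreover have "F (free_lie_gen x) = h x" for x
    by (simp add: free_lie_gen.abs_eq F_abs E_single)
  ultimately show ?thesis by blast
qed

lift_definition dolan_grady_generator :: "dolan_grady_gen \<Rightarrow> 'k::field dolan_grady"
  is free_lie_gen .

lemma dolan_grady_relations:
  fixes A B :: "'k::field dolan_grady"
  defines "A \<equiv> dolan_grady_generator gen_A" and "B \<equiv> dolan_grady_generator gen_B"
  shows "dolan_grady_bracket A (dolan_grady_bracket A (dolan_grady_bracket A B)) =
      dolan_grady_scale 4 (dolan_grady_bracket A B)"
    and "dolan_grady_bracket B (dolan_grady_bracket B (dolan_grady_bracket B A)) =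
      dolan_grady_scale 4 (dolan_grady_bracket B A)"
proof -
  have "dolan_grady_bracket A (dolan_grady_bracket A (dolan_grady_bracket A B)) -
      dolan_grady_scale 4 (dolan_grady_bracket A B) = 0"
    unfolding A_def B_def
    by (transfer, rule free_lie.cong_mod_generator)
      (simp add: dolan_grady_relators_def dolan_grady_relator_def)
  moreover have "dolan_grady_bracket B (dolan_grady_bracket B (dolan_grady_bracket B A)) -
      dolan_grady_scale 4 (dolan_grady_bracket B A) = 0"
    unfolding A_def B_def
    by (transfer, rule free_lie.cong_mod_generator)
      (simp add: dolan_grady_relators_def dolan_grady_relator_def)
  ultimately show "dolan_grady_bracket A (dolan_grady_bracket A (dolan_grady_bracket A B)) =
      dolan_grady_scale 4 (dolan_grady_bracket A B)"
    and "dolan_grady_bracket B (dolan_grady_bracket B (dolan_grady_bracket B A)) =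
      dolan_grady_scale 4 (dolan_grady_bracket B A)"
    by simp_all
qed

lemma dolan_grady_universal:
  assumes "lie_algebra s br"
    and xy: "br x (br x (br x y)) = s 4 (br x y)"
    and yx: "br y (br y (br y x)) = s 4 (br y x)"
  shows "\<exists>F. lie_algebra_hom dolan_grady_scale dolan_grady_bracket s br F \<and>
    F (dolan_grady_generator gen_A) = x \<and> F (dolan_grady_generator gen_B) = y"
proof -
  interpret lie_algebra s br by fact
  obtain E where "lie_algebra_hom free_lie_scale free_lie_bracket s br E"
    and E_gen: "\<And>i. E (free_lie_gen i) = (case i of gen_A \<Rightarrow> x | gen_B \<Rightarrow> y)"
    using free_lie_universal[OF assms(1), of "case_dolan_grady_gen x y"] by blast
  then interpret E: lie_algebra_hom free_lie_scale free_lie_bracket s br E by simp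
  have E_cong: "E p = E q" if "free_lie.cong_mod dolan_grady_relators p q" for p q
    by (rule hom_eq_if_cong_mod[where f = E, OF _ _ _ _ _ that])
      (unfold_locales, auto simp: dolan_grady_relators_def dolan_grady_relator_def
        E.diff E.scale E.map_bracket E_gen xy yx)
  define F where "F z = E (rep_dolan_grady z)" for z
  have F_abs: "F (abs_dolan_grady p) = E p" for p
    unfolding F_def
    by (intro E_cong Quotient3_rep_abs[OF Quotient3_dolan_grady] equivp_reflp[OF free_lie.equivp_cong_mod])
  have "lie_algebra_hom dolan_grady_scale dolan_grady_bracket s br F"
  proof
    fix x y c
    show "F (x + y) = F x + F y"
      by (induction x rule: dolan_grady.abs_induct; induction y rule: dolan_grady.abs_induct)
        (simp add: plus_dolan_grady.abs_eq F_abs E.add)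
    show "F (dolan_grady_scale c x) = s c (F x)"
      by (induction x rule: dolan_grady.abs_induct) (simp add: dolan_grady_scale.abs_eq F_abs E.scale)
    show "F (dolan_grady_bracket x y) = br (F x) (F y)"
      by (induction x rule: dolan_grady.abs_induct; induction y rule: dolan_grady.abs_induct)
        (simp add: dolan_grady_bracket.abs_eq F_abs E.map_bracket)
  qed
  moreover have "F (dolan_grady_generator gen_A) = x" "F (dolan_grady_generator gen_B) = y"
    by (simp_all add: dolan_grady_generator.abs_eq F_abs E_gen)
  ultimately show ?thesis by blast
qed

text \<open>Induction along the construction of the algebra, phrased for a subalgebra containing the
  generators.\<close>

lemma dolan_grady_generated:
  fixes V :: "'k::field dolan_grady set"
  assumes "dolan_grady.subspace V" "\<And>x y. x \<in> V \<Longrightarrow> y \<in> V \<Longrightarrow> dolan_grady_bracket x y \<in> V"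
    and "\<And>i. dolan_grady_generator i \<in> V"
  shows "z \<in> V"
proof -
  define \<pi> :: "_ \<Rightarrow> 'k dolan_grady" where "\<pi> p = abs_dolan_grady (abs_free_lie p)" for p
  have "\<pi> p \<in> V" for p
  proof (induction p rule: pm_basis_induct)
    case zero
    have "\<pi> 0 = 0"
      by (simp add: \<pi>_def zero_free_lie.abs_eq zero_dolan_grady.abs_eq)
    then show ?case
      using assms(1) dolan_grady.subspace_0 by simp
  next
    case (basis t)
    show ?case
    proof (induction t)
      case (Gen i)
      have "\<pi> (Poly_Mapping.single (Gen i) 1) = dolan_grady_generator i"
        by (simp add: \<pi>_def free_lie_gen.abs_eq dolan_grady_generator.abs_eq)
      then show ?case
        using assms(3) by simp
    next
      case (Prod t u)
      have "\<pi> (Poly_Mapping.single (Prod t u) 1) =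
          dolan_grady_bracket (\<pi> (Poly_Mapping.single t 1)) (\<pi> (Poly_Mapping.single u 1))"
        by (simp add: \<pi>_def free_lie_bracket.abs_eq dolan_grady_bracket.abs_eq magma_mult_def
            bilinear_extension_single)
      then show ?case
        using assms(2) Prod by simp
    qed
  next
    case (add p q)
    have "\<pi> (p + q) = \<pi> p + \<pi> q"
      by (simp add: \<pi>_def plus_free_lie.abs_eq plus_dolan_grady.abs_eq)
    then show ?case
      using assms(1) add dolan_grady.subspace_add by simp
  next
    case (scale c p)
    have "\<pi> (pm_scale c p) = dolan_grady_scale c (\<pi> p)"
      by (simp add: \<pi>_def free_lie_scale.abs_eq dolan_grady_scale.abs_eq)
    then show ?case
      using assms(1) scale dolan_grady.subspace_scale by simp
  qed
  then show ?thesis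
    by (induction z rule: dolan_grady.abs_induct, rename_tac w,
        induct_tac w rule: free_lie.abs_induct) (simp add: \<pi>_def)
qed

section \<open>The Onsager algebra is a Lie algebra\<close>

interpretation onsager: nonassoc_algebra onsager_scale onsager_bracket
  unfolding onsager_scale_def onsager_bracket_def by (rule nonassoc_algebra_bilinear_extension)

definition onsager_A :: "int \<Rightarrow> 'k::field onsager"
  where "onsager_A m = Poly_Mapping.single (A m) 1"

text \<open>The odd extension of the basis elements \<open>G n\<close> to integer indices. With it, each bracket of
  spanning elements is given by a single formula, and the Jacobi identity is checked by
  cancellation instead of by ordering the indices.\<close>

definition onsager_G :: "int \<Rightarrow> 'k::field onsager"
  where "onsager_G n = (if n > 0 then Poly_Mapping.single (G (num_of_nat (nat n))) 1
    else if n < 0 then - Poly_Mapping.single (G (num_of_nat (nat (- n)))) 1 else 0)"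

lemma onsager_G_minus: "onsager_G (- n) = - onsager_G n"
  by (simp add: onsager_G_def)

lemma onsager_G_swap: "onsager_G (m - n) = - onsager_G (n - m)"
  using onsager_G_minus[of "n - m"] by simp

lemma onsager_G_0 [simp]: "onsager_G 0 = 0"
  by (simp add: onsager_G_def)

lemma onsager_bracket_single:
  "onsager_bracket (Poly_Mapping.single a 1) (Poly_Mapping.single b 1) = onsager_structure a b"
  unfolding onsager_bracket_def by (rule bilinear_extension_single)

lemma nat_of_num_of_nat_nat: "n > 0 \<Longrightarrow> int (nat_of_num (num_of_nat (nat n))) = n"
  by (simp add: num_of_nat_inverse)

lemma onsager_bracket_A_A:
  "onsager_bracket (onsager_A l) (onsager_A m) = onsager_scale 2 (onsager_G (l - m))"
  by (auto simp: onsager_A_def onsager_G_def onsager_bracket_single onsager_scale_def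
      lookup_single when_def intro!: poly_mapping_eqI)

lemma onsager_bracket_G_A:
  "onsager_bracket (onsager_G n) (onsager_A m) = onsager_A (m + n) - onsager_A (m - n)"
  by (auto simp: onsager_A_def onsager_G_def onsager_bracket_single onsager.bracket_minus_left
      nat_of_num_of_nat_nat)

lemma onsager_bracket_A_G:
  "onsager_bracket (onsager_A m) (onsager_G n) = onsager_A (m - n) - onsager_A (m + n)"
  by (auto simp: onsager_A_def onsager_G_def onsager_bracket_single onsager.bracket_minus_right
      nat_of_num_of_nat_nat)

lemma onsager_bracket_G_G: "onsager_bracket (onsager_G l) (onsager_G m) = 0"
  by (simp add: onsager_G_def onsager_bracket_single onsager.bracket_minus_left
      onsager.bracket_minus_right)

lemma onsager_induct [case_names zero A G add scale]:
  assumes zero: "P 0"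
    and A: "\<And>m. P (onsager_A m)"
    and G: "\<And>n. P (onsager_G n)"
    and add: "\<And>x y. P x \<Longrightarrow> P y \<Longrightarrow> P (x + y)"
    and scale: "\<And>c x. P x \<Longrightarrow> P (onsager_scale c x)"
  shows "P (x :: 'k::field onsager)"
proof (induction x rule: pm_basis_induct)
  case (basis b)
  show ?case
  proof (cases b)
    case (A m)
    then show ?thesis using assms(2)[of m] by (simp add: onsager_A_def)
  next
    case (G l)
    have "onsager_G (int (nat_of_num l)) = Poly_Mapping.single (G l) (1 :: 'k)"
      by (simp add: onsager_G_def nat_of_num_pos nat_of_num_inverse)
    then show ?thesis using assms(3) G by metis
  qed
qed (use zero add scale in \<open>simp_all add: onsager_scale_def\<close>)

lemma onsager_bracket_antisym: "onsager_bracket x y = - onsager_bracket y x"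
proof (induction x rule: onsager_induct)
  case (A m)
  show ?case
  proof (induction y rule: onsager_induct)
    case (A n)
    show ?case
      by (simp add: onsager_bracket_A_A onsager_G_swap[of m n])
  qed (simp_all add: onsager.bracket_add_left onsager.bracket_add_right onsager.bracket_scale_left
      onsager.bracket_scale_right onsager_bracket_A_G onsager_bracket_G_A)
next
  case (G m)
  show ?case
    by (induction y rule: onsager_induct)
      (simp_all add: onsager.bracket_add_left onsager.bracket_add_right onsager.bracket_scale_left
        onsager.bracket_scale_right onsager_bracket_G_G onsager_bracket_A_G onsager_bracket_G_A)
qed (simp_all add: onsager.bracket_add_left onsager.bracket_add_right onsager.bracket_scale_left
        onsager.bracket_scale_right)

lemma onsager_bracket_self: "onsager_bracket x x = 0"
proof (induction x rule: onsager_induct)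
  case (add x y)
  then show ?case
    using onsager_bracket_antisym[of x y]
    by (simp add: onsager.bracket_add_left onsager.bracket_add_right)
qed (simp_all add: onsager.bracket_scale_left onsager.bracket_scale_right onsager_bracket_A_A
    onsager_bracket_G_G)

definition onsager_jacobiator :: "'k::field onsager \<Rightarrow> 'k onsager \<Rightarrow> 'k onsager \<Rightarrow> 'k onsager" where
  "onsager_jacobiator x y z = onsager_bracket x (onsager_bracket y z) +
    onsager_bracket y (onsager_bracket z x) + onsager_bracket z (onsager_bracket x y)"

lemma onsager_jacobiator_linear:
  "onsager_jacobiator 0 y z = 0" "onsager_jacobiator x 0 z = 0" "onsager_jacobiator x y 0 = 0"
  "onsager_jacobiator (x + x') y z = onsager_jacobiator x y z + onsager_jacobiator x' y z"
  "onsager_jacobiator x (y + y') z = onsager_jacobiator x y z + onsager_jacobiator x y' z"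
  "onsager_jacobiator x y (z + z') = onsager_jacobiator x y z + onsager_jacobiator x y z'"
  "onsager_jacobiator (onsager_scale c x) y z = onsager_scale c (onsager_jacobiator x y z)"
  "onsager_jacobiator x (onsager_scale c y) z = onsager_scale c (onsager_jacobiator x y z)"
  "onsager_jacobiator x y (onsager_scale c z) = onsager_scale c (onsager_jacobiator x y z)"
  by (simp_all add: onsager_jacobiator_def onsager.bracket_add_left onsager.bracket_add_right
      onsager.bracket_scale_left onsager.bracket_scale_right algebra_simps)

text \<open>Cyclic symmetry leaves only one arrangement of the arguments to check for each number of \<open>G\<close>
  among them.\<close>

lemma onsager_jacobiator_rotate: "onsager_jacobiator x y z = onsager_jacobiator y z x"
  by (simp add: onsager_jacobiator_def add_ac)

lemma onsager_jacobiator_A_A_A: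
  "onsager_jacobiator (onsager_A l) (onsager_A m) (onsager_A n) = 0"
  by (simp add: onsager_jacobiator_def onsager_bracket_A_A onsager_bracket_A_G
      onsager.bracket_scale_right onsager.scale_right_diff_distrib algebra_simps)

lemma onsager_jacobiator_A_A_G:
  "onsager_jacobiator (onsager_A l) (onsager_A m) (onsager_G n) = 0"
  by (simp add: onsager_jacobiator_def onsager_bracket_A_A onsager_bracket_A_G onsager_bracket_G_A
      onsager_bracket_G_G onsager.bracket_scale_right onsager.bracket_diff_right
      onsager_G_swap[of m "l + n"] onsager_G_swap[of "m + n" l] algebra_simps)

lemma onsager_jacobiator_A_G_G:
  "onsager_jacobiator (onsager_A l) (onsager_G m) (onsager_G n) = 0"
  by (simp add: onsager_jacobiator_def onsager_bracket_A_G onsager_bracket_G_A onsager_bracket_G_G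
      onsager.bracket_diff_right algebra_simps)

lemma onsager_jacobiator_G_G_G:
  "onsager_jacobiator (onsager_G l) (onsager_G m) (onsager_G n) = 0"
  by (simp add: onsager_jacobiator_def onsager_bracket_G_G)

lemma onsager_jacobiator_A_G:
  assumes "x \<in> range onsager_A \<union> range onsager_G"
    and "y \<in> range onsager_A \<union> range onsager_G"
    and "z \<in> range onsager_A \<union> range onsager_G"
  shows "onsager_jacobiator x y z = 0"
  using assms onsager_jacobiator_rotate[of x y z] onsager_jacobiator_rotate[of z x y]
  by (elim UnE rangeE) (simp_all only: onsager_jacobiator_A_A_A onsager_jacobiator_A_A_G
      onsager_jacobiator_A_G_G onsager_jacobiator_G_G_G)

text \<open>By trilinearity the arguments can be replaced, one after the other, by elements of the spanning
  set.\<close>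

lemma onsager_jacobiator_eq_0:
  fixes x y z :: "'k::field onsager"
  shows "onsager_jacobiator x y z = 0"
proof -
  let ?B = "range onsager_A \<union> range onsager_G"
  have 1: "onsager_jacobiator x y z = 0" if "x \<in> ?B" "y \<in> ?B" for x y z :: "'k onsager"
    by (induction z rule: onsager_induct)
      (use that in \<open>simp_all add: onsager_jacobiator_linear onsager_jacobiator_A_G\<close>)
  have 2: "onsager_jacobiator x y z = 0" if "x \<in> ?B" for x y z :: "'k onsager"
    by (induction y rule: onsager_induct)
      (use that in \<open>simp_all add: onsager_jacobiator_linear 1\<close>)
  show ?thesis
    by (induction x rule: onsager_induct) (simp_all add: onsager_jacobiator_linear 2)
qed

interpretation onsager: lie_algebra onsager_scale onsager_bracket
  by unfold_locales
    (simp_all only: onsager_bracket_self onsager_jacobiator_eq_0 flip: onsager_jacobiator_def)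

lemma onsager_dolan_grady_relations:
  fixes A B :: "'k::field onsager"
  defines "A \<equiv> onsager_A 0" and "B \<equiv> onsager_A 1"
  shows "onsager_bracket A (onsager_bracket A (onsager_bracket A B)) =
      onsager_scale 4 (onsager_bracket A B)"
    and "onsager_bracket B (onsager_bracket B (onsager_bracket B A)) =
      onsager_scale 4 (onsager_bracket B A)"
proof -
  have 8: "onsager_scale 8 x = onsager_scale 4 x + onsager_scale 4 x" for x :: "'k onsager"
    using onsager.scale_left_distrib[of 4 4 x] by simp
  show "onsager_bracket A (onsager_bracket A (onsager_bracket A B)) =
      onsager_scale 4 (onsager_bracket A B)"
    and "onsager_bracket B (onsager_bracket B (onsager_bracket B A)) =
      onsager_scale 4 (onsager_bracket B A)"
    by (simp_all add: A_def B_def 8 onsager_bracket_A_A onsager_bracket_A_G onsager_G_minus[of 1]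
        onsager.bracket_scale_right onsager.bracket_minus_right onsager.bracket_diff_right
        onsager.scale_right_diff_distrib)
qed

lemma onsager_recurrence_onsager: "onsager_recurrence onsager_scale onsager_bracket
  (onsager_G 1 :: 'k::field_char_0 onsager) onsager_A"
  by unfold_locales (simp add: onsager_bracket_G_A)

section \<open>The isomorphism\<close>

theorem proposition2p2p2:
  shows "lie_algebra_isomorphic
    (onsager_scale :: 'k::field_char_0 \<Rightarrow> 'k onsager \<Rightarrow> 'k onsager) onsager_bracket
    dolan_grady_scale dolan_grady_bracket"
proof -
  let ?s = "dolan_grady_scale :: 'k \<Rightarrow> _"
  interpret DG: lie_algebra_char_0 ?s dolan_grady_bracket
    by unfold_locales
  obtain g :: "'k dolan_grady" and a where "onsager_sequence ?s dolan_grady_bracket g a"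
    and a: "a 0 = dolan_grady_generator gen_A" "a 1 = dolan_grady_generator gen_B"
    using DG.onsager_sequence_exists[OF dolan_grady_relations] by blast
  then interpret S: onsager_sequence ?s dolan_grady_bracket g a
    by simp
  \<comment> \<open>The factor 1/2 is due to \<open>h n\<close> standing for twice the basis element.\<close>
  define \<psi> :: "'k onsager \<Rightarrow> 'k dolan_grady"
    where "\<psi> = linear_extension dolan_grady_scale
      (\<lambda>b. case b of A m \<Rightarrow> a m | G l \<Rightarrow> dolan_grady_scale (1 / 2) (S.h (int (nat_of_num l))))"
  have \<psi>_single: "\<psi> (Poly_Mapping.single b 1) = (case b of A m \<Rightarrow> a m
      | G l \<Rightarrow> dolan_grady_scale (1 / 2) (S.h (int (nat_of_num l))))" for b
    unfolding \<psi>_def by (rule linear_extension_single) unfold_locales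
  have lin: "Vector_Spaces.linear onsager_scale dolan_grady_scale \<psi>"
    unfolding \<psi>_def onsager_scale_def by (rule linear_linear_extension) unfold_locales
  interpret \<psi>: Vector_Spaces.linear onsager_scale dolan_grady_scale \<psi>
    by (rule lin)
  have \<psi>_A: "\<psi> (onsager_A m) = a m" for m
    by (simp add: onsager_A_def \<psi>_single)
  have \<psi>_G: "\<psi> (onsager_G n) = dolan_grady_scale (1 / 2) (S.h n)" for n
    using S.h_minus[of n] S.h_minus[of 0]
    by (auto simp: onsager_G_def \<psi>_single \<psi>.neg nat_of_num_of_nat_nat S.h_def dolan_grady.bracket_self)
  have \<psi>_mult: "\<psi> (onsager_bracket x y) = dolan_grady_bracket (\<psi> x) (\<psi> y)" for x y
  proof (induction x rule: onsager_induct)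
    case (A m)
    show ?case
      by (induction y rule: onsager_induct)
        (simp_all add: onsager.bracket_add_right onsager.bracket_scale_right dolan_grady.bracket_add_right
          dolan_grady.bracket_scale_right \<psi>.add \<psi>.scale \<psi>.diff \<psi>_A \<psi>_G onsager_bracket_A_A
          onsager_bracket_A_G S.bracket_a_a S.bracket_a_h)
  next
    case (G n)
    show ?case
      by (induction y rule: onsager_induct)
        (simp_all add: onsager.bracket_add_right onsager.bracket_scale_right dolan_grady.bracket_add_right
          dolan_grady.bracket_scale_right dolan_grady.bracket_scale_left \<psi>.add \<psi>.scale \<psi>.diff \<psi>_A \<psi>_G
          onsager_bracket_G_A onsager_bracket_G_G S.bracket_h_a S.bracket_h_h)
  qed (simp_all add: onsager.bracket_add_left onsager.bracket_scale_left dolan_grady.bracket_add_left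
      dolan_grady.bracket_scale_left \<psi>.add \<psi>.scale)
  interpret \<psi>: lie_algebra_hom onsager_scale onsager_bracket dolan_grady_scale dolan_grady_bracket \<psi>
    by unfold_locales (rule \<psi>_mult)
  obtain \<phi> :: "'k dolan_grady \<Rightarrow> 'k onsager" where
    "lie_algebra_hom dolan_grady_scale dolan_grady_bracket onsager_scale onsager_bracket \<phi>"
    and \<phi>_gen: "\<phi> (dolan_grady_generator gen_A) = onsager_A 0" "\<phi> (dolan_grady_generator gen_B) = onsager_A 1"
    using dolan_grady_universal[OF onsager.lie_algebra_axioms onsager_dolan_grady_relations] by blast
  then interpret \<phi>: lie_algebra_hom dolan_grady_scale dolan_grady_bracket onsager_scale
    onsager_bracket \<phi> by simp
  have \<phi>_h: "\<phi> (S.h n) = onsager_bracket (\<phi> (a n)) (\<phi> (a 0))" for n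
    by (simp add: S.h_def \<phi>.map_bracket)
  have \<phi>_g: "\<phi> g = onsager_G 1"
  proof -
    have "onsager_scale 2 (\<phi> g) = onsager_scale 2 (onsager_G 1)"
      unfolding \<phi>.scale[symmetric] S.neighbour[of 0, symmetric] \<phi>.map_bracket
      by (simp add: a \<phi>_gen onsager_bracket_A_A)
    then show ?thesis by simp
  qed
  have "onsager_recurrence onsager_scale onsager_bracket (onsager_G 1) (\<lambda>m. \<phi> (a m))"
    by unfold_locales (simp add: S.g_a \<phi>.diff flip: \<phi>_g \<phi>.map_bracket)
  \<comment> \<open>A solution of the recurrence is determined by its values at 0 and 1.\<close>
  then have \<phi>_a: "\<phi> (a m) = onsager_A m" for m
    using onsager_recurrence_unique[OF _ onsager_recurrence_onsager] a \<phi>_gen by metis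
  have \<phi>_\<psi>: "\<phi> (\<psi> x) = x" for x
    by (induction x rule: onsager_induct)
      (simp_all add: \<psi>_A \<psi>_G \<psi>.add \<psi>.scale \<phi>.add \<phi>.scale \<phi>_a \<phi>_h onsager_bracket_A_A)
  have "z \<in> range \<psi>" for z
  proof (rule dolan_grady_generated)
    show "dolan_grady.subspace (range \<psi>)"
      by (simp add: \<psi>.subspace_image)
    show "dolan_grady_bracket x y \<in> range \<psi>" if "x \<in> range \<psi>" "y \<in> range \<psi>" for x y
      using that by (auto simp flip: \<psi>.map_bracket)
    show "dolan_grady_generator i \<in> range \<psi>" for i
      by (cases i) (simp_all flip: a \<psi>_A)
  qed
  then have "bij \<psi>"
    by (intro bijI) (auto intro: inj_on_inverseI \<phi>_\<psi>)
  then show ?thesis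
    unfolding lie_algebra_isomorphic_def using \<psi>.lie_algebra_hom_axioms by blast
qed

end
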